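(* Every $\Pi$-graph contains the Farey graph as a tight minor, i.e. as a minor all of whose branch sets are finite.
   Context: Graphs are simple and may be infinite. The Farey graph is the graph with vertex set $\mathbb{Q}\cup\{\infty\}$ in which two rationals $a/b$ and $c/d$ written in lowest terms (allowing $\infty=(\pm1)/0$) are adjacent if and only if $ad-bc=\pm1$. A graph is infinitely edge-connected if it has at least two vertices and $G-E'$ is connected for every finite set $E'$ of edges. Paths are independent if they are internally vertex-disjoint. A $\Pi$-graph is an infinitely edge-connected graph that does not contain infinitely many independent paths between any two of its vertices. A graph $H$ is a minor of $G$ if there are pairwise disjoint non-empty vertex sets $V_h\subseteq V(G)$ ($h\in V(H)$), each inducing a connected subgraph of $G$ (the branch sets), such that for every edge $hh'$ of $H$ there is an edge of $G$ between $V_h$ and $V_{h'}$. A tight minor is a minor in which all branch sets are finite. *)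

theory Defs
  imports Complex_Main "HOL-Library.Infinite_Set"
begin

definition simple_graph :: "'a set \<Rightarrow> 'a set set \<Rightarrow> bool" where
  "simple_graph V E \<longleftrightarrow> (\<forall>e\<in>E. \<exists>x y. x \<noteq> y \<and> x \<in> V \<and> y \<in> V \<and> e = {x, y})"

definition connected_set :: "'a set set \<Rightarrow> 'a set \<Rightarrow> bool" where
  "connected_set E S \<longleftrightarrow>
     (\<forall>x\<in>S. \<forall>y\<in>S. (\<lambda>a b. a \<in> S \<and> b \<in> S \<and> {a, b} \<in> E)\<^sup>*\<^sup>* x y)"

definition inf_edge_connected :: "'a set \<Rightarrow> 'a set set \<Rightarrow> bool" where
  "inf_edge_connected V E \<longleftrightarrow>
     (\<exists>x\<in>V. \<exists>y\<in>V. x \<noteq> y) \<and> (\<forall>F. finite F \<longrightarrow> connected_set (E - F) V)"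

definition is_path :: "'a set \<Rightarrow> 'a set set \<Rightarrow> 'a \<Rightarrow> 'a \<Rightarrow> 'a list \<Rightarrow> bool" where
  "is_path V E u v p \<longleftrightarrow> p \<noteq> [] \<and> distinct p \<and> set p \<subseteq> V \<and> hd p = u \<and> last p = v \<and>
     (\<forall>i. Suc i < length p \<longrightarrow> {p ! i, p ! Suc i} \<in> E)"

definition inner_vertices :: "'a list \<Rightarrow> 'a set" where
  "inner_vertices p = set (butlast (tl p))"

definition inf_indep_paths :: "'a set \<Rightarrow> 'a set set \<Rightarrow> 'a \<Rightarrow> 'a \<Rightarrow> bool" where
  "inf_indep_paths V E u v \<longleftrightarrow>
     (\<exists>P. infinite P \<and> (\<forall>p\<in>P. is_path V E u v p) \<and>
          (\<forall>p\<in>P. \<forall>q\<in>P. p \<noteq> q \<longrightarrow> inner_vertices p \<inter> inner_vertices q = {}))"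

definition Pi_graph :: "'a set \<Rightarrow> 'a set set \<Rightarrow> bool" where
  "Pi_graph V E \<longleftrightarrow> simple_graph V E \<and> inf_edge_connected V E \<and>
     (\<forall>u\<in>V. \<forall>v\<in>V. \<not> inf_indep_paths V E u v)"

definition minor_via :: "'b set \<Rightarrow> 'b set set \<Rightarrow> 'a set \<Rightarrow> 'a set set \<Rightarrow> ('b \<Rightarrow> 'a set) \<Rightarrow> bool" where
  "minor_via VH EH V E B \<longleftrightarrow>
     (\<forall>h\<in>VH. B h \<noteq> {} \<and> B h \<subseteq> V \<and> connected_set E (B h)) \<and>
     (\<forall>h\<in>VH. \<forall>h'\<in>VH. h \<noteq> h' \<longrightarrow> B h \<inter> B h' = {}) \<and>
     (\<forall>h h'. {h, h'} \<in> EH \<longrightarrow> (\<exists>x\<in>B h. \<exists>y\<in>B h'. {x, y} \<in> E))"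

definition tight_minor :: "'b set \<Rightarrow> 'b set set \<Rightarrow> 'a set \<Rightarrow> 'a set set \<Rightarrow> bool" where
  "tight_minor VH EH V E \<longleftrightarrow>
     (\<exists>B. minor_via VH EH V E B \<and> (\<forall>h\<in>VH. finite (B h)))"

text \<open>Farey graph: vertices are rat option, None standing for \<infinity> = 1/0.
  A rational is written in lowest terms via quotient_of (denominator positive).\<close>
definition farey_frac :: "rat option \<Rightarrow> int \<times> int" where
  "farey_frac x = (case x of None \<Rightarrow> (1, 0) | Some q \<Rightarrow> quotient_of q)"

definition farey_adj :: "rat option \<Rightarrow> rat option \<Rightarrow> bool" where
  "farey_adj x y \<longleftrightarrow> (let (a, b) = farey_frac x; (c, d) = farey_frac y in
                          a * d - b * c = 1 \<or> a * d - b * c = -1)"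

definition Farey_V :: "rat option set" where
  "Farey_V = UNIV"

definition Farey_E :: "rat option set set" where
  "Farey_E = {{x, y} | x y. farey_adj x y}"

end

theory Submission
  imports Defs
begin

text \<open>
  Call \<open>x\<close> and \<open>y\<close> infinitely linked through \<open>K\<close> if no finite set of edges meets all \<open>x\<close>--\<open>y\<close> paths
  whose interior is non-empty and contained in \<open>K\<close>. As there are only finitely many independent paths, some finite
  \<open>S \<subseteq> K\<close> meets all these paths; by pigeonhole \<open>K\<close> may be replaced by one of its components meeting
  \<open>S\<close>. Inside that component, \<open>S\<close> and a neighbour of each of \<open>x\<close>, \<open>y\<close> lie in a finite connected set \<open>Z\<close>.
  Cutting the paths at their first and last vertices in \<open>Z\<close>, pigeonhole yields \<open>a, b \<in> Z\<close> such that
  \<open>x, a\<close> and \<open>b, y\<close> are infinitely linked through disjoint subsets of \<open>K - Z\<close>. So \<open>Z\<close> is the branch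
  set of the mediant of \<open>x\<close> and \<open>y\<close>, and the construction recurses along the Stern--Brocot tree without
  ever enlarging a branch set. Starting with an edge \<open>xy\<close> and \<open>K = V - {x, y}\<close>, the set \<open>{x, y}\<close>
  represents \<open>\<infinity>\<close> and the first \<open>Z\<close> represents \<open>0\<close>.
\<close>

section \<open>Reachability and connected sets\<close>

definition reach :: "'a set set \<Rightarrow> 'a set \<Rightarrow> 'a \<Rightarrow> 'a \<Rightarrow> bool" where
  "reach E S = (\<lambda>a b. a \<in> S \<and> b \<in> S \<and> {a, b} \<in> E)\<^sup>*\<^sup>*"

lemma connected_set_reach: "connected_set E S \<longleftrightarrow> (\<forall>x\<in>S. \<forall>y\<in>S. reach E S x y)"
  by (simp add: connected_set_def reach_def)

lemma reach_refl [simp]: "reach E S x x"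
  by (simp add: reach_def)

lemma reach_trans: "reach E S x y \<Longrightarrow> reach E S y z \<Longrightarrow> reach E S x z"
  unfolding reach_def by (rule rtranclp_trans)

lemma reach_step: "reach E S x y \<Longrightarrow> y \<in> S \<Longrightarrow> z \<in> S \<Longrightarrow> {y, z} \<in> E \<Longrightarrow> reach E S x z"
  unfolding reach_def by (simp add: rtranclp.rtrancl_into_rtrancl)

lemma reach_edge: "x \<in> S \<Longrightarrow> y \<in> S \<Longrightarrow> {x, y} \<in> E \<Longrightarrow> reach E S x y"
  using reach_step reach_refl by metis

lemma reach_induct [consumes 1, case_names refl step]:
  assumes "reach E S x y" "P x"
    and "\<And>y z. reach E S x y \<Longrightarrow> y \<in> S \<Longrightarrow> z \<in> S \<Longrightarrow> {y, z} \<in> E \<Longrightarrow> P y \<Longrightarrow> P z"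
  shows "P y"
  using assms(1) unfolding reach_def
proof (induction rule: rtranclp_induct)
  case base
  show ?case by (rule assms(2))
next
  case (step y z)
  then show ?case using assms(3)[of y z] by (simp add: reach_def)
qed

lemma reach_sym: "reach E S x y \<Longrightarrow> reach E S y x"
proof (induction rule: reach_induct)
  case (step y z)
  then have "reach E S z y" by (intro reach_edge) (auto simp: insert_commute)
  with step show ?case using reach_trans by metis
qed simp

lemma reach_mono:
  assumes "reach E S x y" "E \<subseteq> E'" "S \<subseteq> S'"
  shows "reach E' S' x y"
  using assms(1)
proof (induction rule: reach_induct)
  case (step y z)
  then show ?case using assms(2,3) reach_step[of E' S' x y z] by blast
qed simp

lemma connected_set_insert:
  assumes "connected_set E Z" "z \<in> Z" "{z, w} \<in> E"
  shows "connected_set E (insert w Z)"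
proof -
  have "reach E (insert w Z) z v" if "v \<in> insert w Z" for v
  proof (cases "v = w")
    case True
    then show ?thesis using assms by (intro reach_edge) auto
  next
    case False
    then have "reach E Z z v" using assms that by (auto simp: connected_set_reach)
    then show ?thesis by (rule reach_mono) auto
  qed
  then show ?thesis unfolding connected_set_reach using reach_trans reach_sym by metis
qed

lemma connected_extend:
  assumes "reach E K s t" "s \<in> Z" "finite Z" "Z \<subseteq> K" "connected_set E Z"
  shows "\<exists>Z'. finite Z' \<and> Z \<subseteq> Z' \<and> t \<in> Z' \<and> Z' \<subseteq> K \<and> connected_set E Z'"
  using assms(1)
proof (induction rule: reach_induct)
  case refl
  then show ?case using assms by blast
next
  case (step y z)
  then obtain Z' where "finite Z'" "Z \<subseteq> Z'" "y \<in> Z'" "Z' \<subseteq> K" "connected_set E Z'" by blast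
  then show ?case using connected_set_insert[of E Z' y z] step
    by (intro exI[of _ "insert z Z'"]) auto
qed

lemma finite_connected_hull:
  assumes "finite T" "\<And>t. t \<in> T \<Longrightarrow> reach E K s t" "s \<in> K"
  shows "\<exists>Z. finite Z \<and> s \<in> Z \<and> T \<subseteq> Z \<and> Z \<subseteq> K \<and> connected_set E Z"
  using assms(1,2)
proof (induction rule: finite_induct)
  case empty
  then show ?case using assms(3)
    by (intro exI[of _ "{s}"]) (auto simp: connected_set_reach)
next
  case (insert t T)
  then obtain Z where "finite Z" "s \<in> Z" "T \<subseteq> Z" "Z \<subseteq> K" "connected_set E Z" by auto
  then obtain Z' where "finite Z' \<and> Z \<subseteq> Z' \<and> t \<in> Z' \<and> Z' \<subseteq> K \<and> connected_set E Z'"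
    using connected_extend[of E K s t Z] insert.prems by auto
  then show ?case using \<open>s \<in> Z\<close> \<open>T \<subseteq> Z\<close> by blast
qed

lemma is_path_successively:
  "is_path V E u v p \<longleftrightarrow> p \<noteq> [] \<and> distinct p \<and> set p \<subseteq> V \<and> hd p = u \<and> last p = v \<and>
     successively (\<lambda>a b. {a, b} \<in> E) p"
  by (auto simp: is_path_def successively_conv_nth)

lemma reach_imp_path:
  assumes "reach E A u v" "u \<in> A"
  shows "\<exists>p. is_path A E u v p"
  using assms(1)
proof (induction rule: reach_induct)
  case refl
  then show ?case using assms(2) by (intro exI[of _ "[u]"]) (simp add: is_path_successively)
next
  case (step y z)
  then obtain p where p: "is_path A E u y p" by blast
  show ?case
  proof (cases "z \<in> set p")
    case True
    \<comment> \<open>If \<open>z\<close> was visited before, the walk has closed a loop, and the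
      path is cut back to its initial piece ending at \<open>z\<close>.\<close>
    then obtain p1 p2 where eq: "p = p1 @ z # p2" by (meson split_list)
    have "successively (\<lambda>a b. {a, b} \<in> E) ((p1 @ [z]) @ p2)"
      using p eq by (simp add: is_path_successively)
    then have "successively (\<lambda>a b. {a, b} \<in> E) (p1 @ [z])"
      by (simp only: successively_append_iff)
    moreover have "hd (p1 @ [z]) = u" using p eq by (cases p1) (auto simp: is_path_def)
    ultimately have "is_path A E u z (p1 @ [z])"
      using p eq by (auto simp: is_path_successively)
    then show ?thesis by blast
  next
    case False
    then have "is_path A E u z (p @ [z])"
      using p step by (auto simp: is_path_successively successively_append_iff)
    then show ?thesis by blast
  qed
qed

section \<open>Linking two vertices through a set\<close>

text \<open>A direct edge from \<open>x\<close> to \<open>y\<close> does not count: the interior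
  must be non-empty, so that disjoint interiors later force distinct paths.\<close>

definition linked :: "'a set set \<Rightarrow> 'a set \<Rightarrow> 'a \<Rightarrow> 'a \<Rightarrow> bool" where
  "linked E K x y \<longleftrightarrow> (\<exists>u\<in>K. \<exists>v\<in>K. {x, u} \<in> E \<and> {y, v} \<in> E \<and> reach E K u v)"

lemma linked_sym: "linked E K x y \<Longrightarrow> linked E K y x"
  unfolding linked_def using reach_sym by metis

lemma linked_mono:
  assumes "linked E K x y" "E \<subseteq> E'" "K \<subseteq> K'"
  shows "linked E' K' x y"
  using assms reach_mono[OF _ assms(2,3)] unfolding linked_def by blast

definition inf_linked :: "'a set \<Rightarrow> 'a set set \<Rightarrow> 'a set \<Rightarrow> 'a \<Rightarrow> 'a \<Rightarrow> bool" where
  "inf_linked V E K x y \<longleftrightarrow> K \<subseteq> V \<and> x \<in> V \<and> y \<in> V \<and> x \<notin> K \<and> y \<notin> K \<and> x \<noteq> y \<and>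
     (\<forall>F. finite F \<longrightarrow> linked (E - F) K x y)"

lemma inf_linked_sym: "inf_linked V E K x y \<Longrightarrow> inf_linked V E K y x"
  unfolding inf_linked_def using linked_sym by metis

lemma inf_linked_edge:
  assumes "inf_edge_connected V E" "x \<in> V" "y \<in> V" "x \<noteq> y"
  shows "inf_linked V E (V - {x, y}) x y"
proof -
  have "linked (E - F) (V - {x, y}) x y" if "finite F" for F
  proof (rule ccontr)
    assume nl: "\<not> linked (E - F) (V - {x, y}) x y"
    let ?K = "V - {x, y}" and ?E = "E - F" and ?E' = "E - insert {x, y} F"
    \<comment> \<open>The edge \<open>{x, y}\<close> is deleted together with \<open>F\<close>. A
      walk from \<open>x\<close> is followed, starting afresh whenever it returns to
      \<open>x\<close>; a step to \<open>y\<close> from elsewhere would give the excluded link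
      through \<open>?K\<close>.\<close>
    have "t = x \<or> (t \<in> ?K \<and> (\<exists>u\<in>?K. {x, u} \<in> ?E \<and> reach ?E ?K u t))"
      if "reach ?E' V x t" for t
      using that
    proof (induction rule: reach_induct)
      case (step v w)
      consider "w = x" | "w = y" | "w \<in> ?K" using step by blast
      then show ?case
      proof cases
        case 2
        then have "v \<noteq> x" using step by auto
        then obtain u where "u \<in> ?K" "v \<in> ?K" "{x, u} \<in> ?E" "reach ?E ?K u v" using step by auto
        then have "linked ?E ?K x y" using step 2 unfolding linked_def
          by (auto simp: insert_commute)
        with nl show ?thesis by blast
      next
        case 3
        show ?thesis
        proof (cases "v = x")
          case True
          then have "{x, w} \<in> ?E" using step by blast
          then have "w \<in> ?K \<and> {x, w} \<in> ?E \<and> reach ?E ?K w w" using 3 by simp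
          then show ?thesis by blast
        next
          case False
          then obtain u where u: "u \<in> ?K" "v \<in> ?K" "{x, u} \<in> ?E" "reach ?E ?K u v"
            using step by auto
          then have "reach ?E ?K u w" using reach_step[of ?E ?K u v w] step 3 by blast
          then show ?thesis using u 3 by blast
        qed
      qed simp
    qed simp
    moreover have "reach ?E' V x y"
      using assms that by (auto simp: inf_edge_connected_def connected_set_reach)
    ultimately show False using assms by blast
  qed
  then show ?thesis using assms by (auto simp: inf_linked_def)
qed

lemma linked_imp_path:
  assumes "linked E A x y" "x \<notin> A" "y \<notin> A" "x \<noteq> y" "A \<subseteq> V" "x \<in> V" "y \<in> V"
  shows "\<exists>p. p \<noteq> [] \<and> set p \<subseteq> A \<and> is_path V E x y (x # p @ [y])"
proof -
  obtain u v where uv: "u \<in> A" "v \<in> A" "{x, u} \<in> E" "{y, v} \<in> E" "reach E A u v"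
    using assms(1) unfolding linked_def by blast
  obtain p where p: "is_path A E u v p" using reach_imp_path uv by metis
  have "is_path V E x y (x # p @ [y])"
    using p uv assms
    by (auto simp: is_path_successively successively_append_iff successively_Cons insert_commute)
  then show ?thesis using p by (auto simp: is_path_def)
qed

section \<open>Finite separators and the splitting of a linked pair\<close>

lemma inner_vertices_Cons_snoc [simp]: "inner_vertices (x # p @ [y]) = set p"
  by (simp add: inner_vertices_def)

text \<open>Without such a set, paths can be chosen greedily, each avoiding the interiors of all
  earlier ones, which gives infinitely many independent paths.\<close>

lemma finite_separator:
  assumes "\<not> inf_indep_paths V E x y"
    and "x \<notin> K" "y \<notin> K" "x \<noteq> y" "K \<subseteq> V" "x \<in> V" "y \<in> V"
  shows "\<exists>S. finite S \<and> S \<subseteq> K \<and> \<not> linked E (K - S) x y"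
proof (rule ccontr)
  assume "\<not> ?thesis"
  then have all: "linked E (K - S) x y" if "finite S" for S
    using that linked_mono[of E "K - (S \<inter> K)" x y E "K - S"] by (metis Diff_Int2 Int_absorb
        Int_lower2 finite_Int subset_refl)
  have "\<exists>p. p \<noteq> [] \<and> set p \<inter> S = {} \<and> is_path V E x y (x # p @ [y])" if fin: "finite S" for S
  proof -
    obtain p where "p \<noteq> [] \<and> set p \<subseteq> K - S \<and> is_path V E x y (x # p @ [y])"
      using linked_imp_path[OF all[OF fin], of V] assms by auto
    then show ?thesis by blast
  qed
  then obtain g where g: "\<And>S. finite S \<Longrightarrow>
      g S \<noteq> [] \<and> set (g S) \<inter> S = {} \<and> is_path V E x y (x # g S @ [y])"
    by metis
  \<comment> \<open>\<open>T n\<close> collects the interiors of the first \<open>n\<close> chosen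
    paths.\<close>
  define T where "T = rec_nat {} (\<lambda>_ S. S \<union> set (g S))"
  have T: "T 0 = {}" "T (Suc n) = T n \<union> set (g (T n))" for n by (simp_all add: T_def)
  have fin: "finite (T n)" for n by (induction n) (auto simp: T)
  have "T m \<subseteq> T n" if "m \<le> n" for m n using that by (rule lift_Suc_mono_le[rotated]) (auto simp: T)
  then have sub: "set (g (T m)) \<subseteq> T n" if "m < n" for m n
    using that T(2)[of m] by (metis Suc_leI Un_upper2 subset_trans)
  have disj: "set (g (T m)) \<inter> set (g (T n)) = {}" if "m \<noteq> n" for m n
    using that sub[of m n] sub[of n m] g[OF fin[of n]] g[OF fin[of m]] by (cases "m < n") auto
  \<comment> \<open>Disjoint interiors distinguish the paths only because each interior is
    non-empty.\<close>
  have "inj (\<lambda>n. x # g (T n) @ [y])"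
  proof (rule injI)
    fix m n assume "x # g (T m) @ [y] = x # g (T n) @ [y]"
    then show "m = n" using disj[of m n] g[OF fin[of n]] by (cases "m = n") auto
  qed
  then have "infinite (range (\<lambda>n. x # g (T n) @ [y]))" by (rule range_inj_infinite)
  moreover have "\<forall>p\<in>range (\<lambda>n. x # g (T n) @ [y]). is_path V E x y p" using g fin by auto
  moreover have "\<forall>p\<in>range (\<lambda>n. x # g (T n) @ [y]). \<forall>q\<in>range (\<lambda>n. x # g (T n) @ [y]).
      p \<noteq> q \<longrightarrow> inner_vertices p \<inter> inner_vertices q = {}"
    using disj by (auto simp del: append_Cons) (metis disjoint_iff)
  ultimately have "inf_indep_paths V E x y" unfolding inf_indep_paths_def by blast
  with assms show False by blast
qed

text \<open>If finite edge sets \<open>F s\<close> cut the link in each of the finitely many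
  components, some link would still avoid their union. It either stays inside one component meeting
  \<open>S\<close> or misses \<open>S\<close>, and both are excluded.\<close>

lemma inf_linked_component:
  assumes good: "inf_linked V E K x y" and S: "finite S" "S \<subseteq> K" "\<not> linked E (K - S) x y"
  shows "\<exists>s\<in>S. inf_linked V E {v \<in> K. reach E K s v} x y"
proof (rule ccontr)
  assume neg: "\<not> ?thesis"
  let ?C = "\<lambda>s. {v \<in> K. reach E K s v}"
  have "\<forall>s\<in>S. \<exists>F. finite F \<and> \<not> linked (E - F) (?C s) x y"
  proof
    fix s assume "s \<in> S"
    then have "\<not> inf_linked V E (?C s) x y" using neg by blast
    moreover have "?C s \<subseteq> V" "x \<in> V" "y \<in> V" "x \<notin> ?C s" "y \<notin> ?C s" "x \<noteq> y"
      using good unfolding inf_linked_def by auto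
    ultimately show "\<exists>F. finite F \<and> \<not> linked (E - F) (?C s) x y" unfolding inf_linked_def by blast
  qed
  then obtain F where F: "\<And>s. s \<in> S \<Longrightarrow> finite (F s) \<and> \<not> linked (E - F s) (?C s) x y"
    by metis
  let ?E = "E - (\<Union>s\<in>S. F s)"
  have "finite (\<Union>s\<in>S. F s)" using F S by auto
  then have "linked ?E K x y" using good unfolding inf_linked_def by blast
  then obtain u v where uv: "u \<in> K" "v \<in> K" "{x, u} \<in> ?E" "{y, v} \<in> ?E" "reach ?E K u v"
    unfolding linked_def by blast
  show False
  proof (cases "\<exists>s\<in>S. reach E K s u")
    case True
    then obtain s where s: "s \<in> S" "reach E K s u" by blast
    have su: "reach E K s a" if "reach ?E K u a" for a
      using reach_trans[OF s(2)] reach_mono[OF that, of E K] by auto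
    have "reach ?E (?C s) u v" using uv(5)
    proof (induction rule: reach_induct)
      case (step a b)
      then have "reach E K s a" using su by blast
      moreover have "reach E K s b" using step reach_step[of ?E K u a b] su by blast
      ultimately show ?case using step reach_step[of ?E "?C s" u a b] by blast
    qed simp
    moreover have "reach E K s v" using uv su by blast
    ultimately have "linked ?E (?C s) x y" using uv s unfolding linked_def by blast
    then have "linked (E - F s) (?C s) x y" using s by (rule_tac linked_mono) auto
    then show False using F s by blast
  next
    case False
    have notS: "a \<notin> S" if "reach ?E K u a" for a
      using False reach_sym[OF reach_mono[OF that, of E K]] by blast
    have "reach ?E (K - S) u v" using uv(5)
    proof (induction rule: reach_induct)
      case (step a b)
      then have "a \<notin> S" "b \<notin> S" using notS reach_step[of ?E K u a b] by blast+
      then show ?case using step reach_step[of ?E "K - S" u a b] by blast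
    qed simp
    moreover have "u \<in> K - S" "v \<in> K - S" using notS[of u] notS[of v] uv by auto
    ultimately have "linked ?E (K - S) x y" using uv unfolding linked_def by blast
    then have "linked E (K - S) x y" by (rule linked_mono) auto
    then show False using S by blast
  qed
qed

text \<open>The union of those components of the subgraph on \<open>A\<close> that contain a
  neighbour of \<open>x\<close>. Using the sides of \<open>x\<close> and \<open>y\<close> keeps the
  two recursive calls disjoint.\<close>

definition side :: "'a set set \<Rightarrow> 'a set \<Rightarrow> 'a \<Rightarrow> 'a set" where
  "side E A x = {v \<in> A. \<exists>u\<in>A. {x, u} \<in> E \<and> reach E A u v}"

lemma sides_disjoint:
  assumes "\<not> linked E A x y"
  shows "side E A x \<inter> side E A y = {}"
proof -
  have False if v: "v \<in> side E A x" "v \<in> side E A y" for v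
  proof -
    obtain u u' where "u \<in> A" "u' \<in> A" "{x, u} \<in> E" "{y, u'} \<in> E" "reach E A u v" "reach E A u' v"
      using v unfolding side_def by blast
    then have "linked E A x y" unfolding linked_def using reach_trans reach_sym by metis
    then show False using assms by blast
  qed
  then show ?thesis by blast
qed

text \<open>Pigeonhole on the first vertex of \<open>Z\<close> met by a path from \<open>x\<close> to \<open>y\<close>.\<close>

lemma inf_linked_side:
  assumes good: "inf_linked V E K x y" and Z: "finite Z" "Z \<subseteq> K" "\<not> linked E (K - Z) x y"
  shows "\<exists>a\<in>Z. inf_linked V E (side E (K - Z) x) x a"
proof (rule ccontr)
  assume neg: "\<not> ?thesis"
  let ?C = "side E (K - Z) x"
  have "\<forall>a\<in>Z. \<exists>F. finite F \<and> \<not> linked (E - F) ?C x a"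
  proof
    fix a assume "a \<in> Z"
    then have "\<not> inf_linked V E ?C x a" using neg by blast
    moreover have "?C \<subseteq> V" "x \<in> V" "a \<in> V" "x \<notin> ?C" "a \<notin> ?C" "x \<noteq> a"
      using good \<open>a \<in> Z\<close> Z unfolding inf_linked_def side_def by auto
    ultimately show "\<exists>F. finite F \<and> \<not> linked (E - F) ?C x a" unfolding inf_linked_def by blast
  qed
  then obtain F where F: "\<And>a. a \<in> Z \<Longrightarrow> finite (F a) \<and> \<not> linked (E - F a) ?C x a"
    by metis
  \<comment> \<open>The edges \<open>{x, a}\<close> are removed too, so that the first interior
    vertex \<open>u\<close> of the remaining link lies outside \<open>Z\<close>.\<close>
  let ?E = "E - (\<Union>a\<in>Z. insert {x, a} (F a))"
  have "finite (\<Union>a\<in>Z. insert {x, a} (F a))" using F Z by auto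
  then have "linked ?E K x y" using good unfolding inf_linked_def by blast
  then obtain u v where uv: "u \<in> K" "v \<in> K" "{x, u} \<in> ?E" "{y, v} \<in> ?E" "reach ?E K u v"
    unfolding linked_def by blast
  have "u \<notin> Z" using uv(3) by blast
  then have uC: "u \<in> ?C" using uv unfolding side_def by auto
  \<comment> \<open>A first step into some \<open>b\<close> of \<open>Z\<close> would link
    \<open>x\<close> to \<open>b\<close> through \<open>?C\<close> while avoiding
    \<open>F b\<close>. Hence the walk stays in \<open>?C\<close> up to the neighbour
    \<open>v\<close> of \<open>y\<close>, contradicting that \<open>Z\<close> separates
    \<open>x\<close> from \<open>y\<close>.\<close>
  have "v \<in> ?C \<and> reach ?E ?C u v"
    using uv(5)
  proof (induction rule: reach_induct)
    case refl
    then show ?case using uC by simp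
  next
    case (step a b)
    have "b \<notin> Z"
    proof
      assume "b \<in> Z"
      have "linked ?E ?C x b" unfolding linked_def
        using uC uv(3) step by (auto simp: insert_commute)
      then have "linked (E - F b) ?C x b" using \<open>b \<in> Z\<close> by (rule_tac linked_mono) auto
      then show False using F \<open>b \<in> Z\<close> by blast
    qed
    moreover have "\<exists>u\<in>K - Z. {x, u} \<in> E \<and> reach E (K - Z) u b"
    proof -
      obtain u' where u': "u' \<in> K - Z" "{x, u'} \<in> E" "reach E (K - Z) u' a" "a \<in> K - Z"
        using step unfolding side_def by blast
      then have "reach E (K - Z) u' b" using step reach_step[of E "K - Z" u' a b] \<open>b \<notin> Z\<close> by blast
      then show ?thesis using u' by blast
    qed
    ultimately have "b \<in> ?C" using step unfolding side_def by auto
    then show ?case using step reach_step[of ?E ?C u a b] by blast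
  qed
  then obtain u' where "u' \<in> K - Z" "{x, u'} \<in> E" "reach E (K - Z) u' v" "v \<in> K - Z"
    unfolding side_def by blast
  then have "linked E (K - Z) x y" using uv unfolding linked_def by blast
  then show False using Z by blast
qed

text \<open>One recursion step along the tree. The ends \<open>a\<close> and \<open>b\<close> may
  differ: only the connected set \<open>Z\<close> containing both has to act as a single vertex of
  the minor.\<close>

definition splits :: "'a set \<Rightarrow> 'a set set \<Rightarrow> 'a set \<times> 'a \<times> 'a \<Rightarrow> 'a set \<Rightarrow>
    'a set \<times> 'a \<times> 'a \<Rightarrow> 'a set \<times> 'a \<times> 'a \<Rightarrow> bool" where
  "splits V E s Z s1 s2 \<longleftrightarrow> (case (s, s1, s2) of ((K, x, y), (C, x', a), (D, b, y')) \<Rightarrow>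
     x' = x \<and> y' = y \<and> a \<in> Z \<and> b \<in> Z \<and> finite Z \<and> Z \<subseteq> K \<and> connected_set E Z \<and>
     (\<exists>z\<in>Z. {x, z} \<in> E) \<and> (\<exists>z\<in>Z. {y, z} \<in> E) \<and>
     C \<subseteq> K - Z \<and> D \<subseteq> K - Z \<and> C \<inter> D = {} \<and> inf_linked V E C x a \<and> inf_linked V E D b y)"

lemma inf_linked_splits:
  assumes good: "inf_linked V E K x y" and noinf: "\<not> inf_indep_paths V E x y"
  shows "\<exists>Z s1 s2. splits V E (K, x, y) Z s1 s2"
proof -
  obtain S where S: "finite S" "S \<subseteq> K" "\<not> linked E (K - S) x y"
    using finite_separator[OF noinf, of K] good unfolding inf_linked_def by blast
  obtain s where s: "s \<in> S" "inf_linked V E {v \<in> K. reach E K s v} x y"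
    using inf_linked_component[OF good S] by blast
  define L where "L = {v \<in> K. reach E K s v}"
  have L: "inf_linked V E L x y" using s by (simp add: L_def)
  then have "linked E L x y" unfolding inf_linked_def by (metis Diff_empty finite.emptyI)
  then obtain u v where uv: "u \<in> L" "v \<in> L" "{x, u} \<in> E" "{y, v} \<in> E"
    unfolding linked_def by blast
  have sL: "s \<in> L" using s S by (auto simp: L_def)
  have reachL: "reach E L s t" if "t \<in> L" for t
  proof -
    have "reach E K s t" using that by (simp add: L_def)
    then show ?thesis
    proof (induction rule: reach_induct)
      case (step a b)
      then have "a \<in> L" "b \<in> L" using reach_step[of E K s a b] by (auto simp: L_def)
      then show ?case using step reach_step[of E L s a b] by blast
    qed simp
  qed
  \<comment> \<open>Including \<open>u\<close> and \<open>v\<close> makes \<open>Z\<close> adjacent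
    to both ends; including \<open>S \<inter> L\<close> makes it separate them within
    \<open>L\<close>.\<close>
  obtain Z where Z: "finite Z" "insert u (insert v (S \<inter> L)) \<subseteq> Z" "Z \<subseteq> L" "connected_set E Z"
    using finite_connected_hull[of "insert u (insert v (S \<inter> L))" E L s] S uv sL reachL by auto
  have nl: "\<not> linked E (L - Z) x y"
  proof
    assume "linked E (L - Z) x y"
    then have "linked E (K - S) x y" using Z by (rule_tac linked_mono) (auto simp: L_def)
    then show False using S by blast
  qed
  obtain a where a: "a \<in> Z" "inf_linked V E (side E (L - Z) x) x a"
    using inf_linked_side[OF L Z(1,3) nl] by blast
  obtain b where b: "b \<in> Z" "inf_linked V E (side E (L - Z) y) y b"
    using inf_linked_side[OF inf_linked_sym[OF L] Z(1,3)] nl linked_sym by metis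
  have "splits V E (K, x, y) Z (side E (L - Z) x, x, a) (side E (L - Z) y, b, y)"
    unfolding splits_def using a b Z uv sides_disjoint[OF nl] inf_linked_sym[OF b(2)]
    by (auto simp: side_def L_def)
  then show ?thesis by blast
qed


section \<open>The Stern--Brocot tree\<close>

text \<open>The mediant, except that at the root \<open>0/1\<close> replaces the meaningless sum
  \<open>0/0\<close>.\<close>

definition middle :: "(int \<times> int) \<times> (int \<times> int) \<Rightarrow> int \<times> int" where
  "middle I = (case I of ((p, q), (r, s)) \<Rightarrow> if q = 0 \<and> s = 0 then (0, 1) else (p + r, q + s))"

text \<open>Words are read from right to left. The root interval runs from \<open>-1/0\<close> to \<open>1/0\<close>, both of which
  stand for \<open>\<infinity>\<close>, so that the Farey graph arises from a single tree.\<close>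

primrec interval :: "bool list \<Rightarrow> (int \<times> int) \<times> (int \<times> int)" where
  "interval [] = ((-1, 0), (1, 0))"
| "interval (b # w) = (if b then (middle (interval w), snd (interval w))
                       else (fst (interval w), middle (interval w)))"

definition node :: "int \<times> int \<Rightarrow> rat option" where
  "node v = (if snd v = 0 then None else Some (of_int (fst v) / of_int (snd v)))"

definition mid_rat :: "bool list \<Rightarrow> rat" where
  "mid_rat w = of_int (fst (middle (interval w))) / of_int (snd (middle (interval w)))"

text \<open>Mediants preserve the determinant. The root is excluded because its determinant is
  \<open>0\<close>; its children already have determinant \<open>1\<close>.\<close>

lemma interval_det:
  assumes "w \<noteq> []" "interval w = ((p, q), (r, s))"
  shows "q \<ge> 0 \<and> s \<ge> 0 \<and> q * r - p * s = 1"
  using assms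
proof (induction w arbitrary: p q r s)
  case (Cons b w)
  obtain p' q' r' s' where I: "interval w = ((p', q'), (r', s'))" by (metis surj_pair)
  show ?case
  proof (cases "w = []")
    case True
    then show ?thesis using Cons.prems by (auto simp: middle_def split: if_splits)
  next
    case False
    then have det: "q' \<ge> 0 \<and> s' \<ge> 0 \<and> q' * r' - p' * s' = 1" using Cons.IH I by blast
    then have "\<not> (q' = 0 \<and> s' = 0)" by auto
    then show ?thesis using det Cons.prems I
      by (auto simp: middle_def algebra_simps split: if_splits)
  qed
qed simp

lemma interval_denom_pos:
  assumes "w \<noteq> []" "interval w = ((p, q), (r, s))"
  shows "q + s > 0"
proof -
  have d: "q \<ge> 0" "s \<ge> 0" "q * r - p * s = 1" using interval_det[OF assms] by auto
  then have "\<not> (q = 0 \<and> s = 0)" by auto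
  with d show ?thesis by linarith
qed

lemma middle_interval:
  assumes "w \<noteq> []" "interval w = ((p, q), (r, s))"
  shows "middle (interval w) = (p + r, q + s)"
  using interval_denom_pos[OF assms] assms(2) by (auto simp: middle_def)

lemma snd_middle_pos: "snd (middle (interval w)) > 0"
proof (cases "w = []")
  case False
  obtain p q r s where I: "interval w = ((p, q), (r, s))" by (metis surj_pair)
  show ?thesis using middle_interval[OF False I] interval_denom_pos[OF False I] by simp
qed (simp add: middle_def)

lemma node_middle: "node (middle (interval w)) = Some (mid_rat w)"
  using snd_middle_pos[of w] by (simp add: node_def mid_rat_def)

text \<open>Serves both for the mediants and for the branch sets. If one word is an ancestor of the
  other, the descendant's set lies below a child and so avoids the ancestor's; otherwise the two
  words lie below different children of a common ancestor.\<close>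

lemma tree_disjoint:
  fixes A M :: "bool list \<Rightarrow> 'b set"
  assumes M: "\<And>w. M w \<subseteq> A w" and A: "\<And>b w. A (b # w) \<subseteq> A w - M w"
    and D: "\<And>w. A (False # w) \<inter> A (True # w) = {}" and "w \<noteq> w'"
  shows "M w \<inter> M w' = {}"
proof -
  have same: "A v \<inter> A v' = {}" if "length v = length v'" "v \<noteq> v'" for v v'
    using that
  proof (induction v v' rule: list_induct2)
    case (Cons b v b' v')
    show ?case
    proof (cases "v = v'")
      case True
      then show ?thesis using Cons.prems D[of v] by (cases b; cases b') auto
    next
      case False
      then show ?thesis using Cons.IH A[of b v] A[of b' v'] by blast
    qed
  qed simp
  have ext: "A (u @ v) \<subseteq> A v" for u v
    using A by (induction u) (simp, fastforce)
  have less: "M v \<inter> M v' = {}" if len: "length v < length v'" for v v'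
  proof -
    \<comment> \<open>Words are read from the right, so the suffix \<open>t\<close> is the ancestor
      of \<open>v'\<close> on the level of \<open>v\<close>.\<close>
    define u where "u = take (length v' - length v) v'"
    define t where "t = drop (length v' - length v) v'"
    have ut: "v' = u @ t" "length t = length v" "u \<noteq> []" using len by (auto simp: u_def t_def)
    show ?thesis
    proof (cases "t = v")
      case True
      obtain u' b where "u = u' @ [b]" using ut(3) by (metis rev_exhaust)
      then have "A v' \<subseteq> A v - M v" using ext[of u' "b # v"] A[of b v] ut True by auto
      then show ?thesis using M[of v'] by blast
    next
      case False
      then show ?thesis using same[of t v] ut ext[of u t] M[of v] M[of v'] by blast
    qed
  qed
  consider "length w < length w'" | "length w' < length w" | "length w = length w'" by linarith
  then show ?thesis
  proof cases
    case 3
    then show ?thesis using same assms(4) M by blast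
  qed (use less in blast)+
qed

text \<open>The open interval from \<open>p/q\<close> to \<open>r/s\<close>, cross-multiplied so
  that the endpoints \<open>-1/0\<close> and \<open>1/0\<close> impose no condition.\<close>

definition between :: "(int \<times> int) \<times> (int \<times> int) \<Rightarrow> rat set" where
  "between I = (case I of ((p, q), (r, s)) \<Rightarrow>
     {x. of_int p < x * of_int q \<and> x * of_int s < of_int r})"

lemma mid_rat_between: "mid_rat w \<in> between (interval w)"
proof (cases "w = []")
  case False
  obtain p q r s where I: "interval w = ((p, q), (r, s))" by (metis surj_pair)
  have pos: "(of_int (q + s) :: rat) > 0" using interval_denom_pos[OF False I] by linarith
  have "q * r - p * s = 1" using interval_det[OF False I] by blast
  then have "p * (q + s) < (p + r) * q" "(p + r) * s < r * (q + s)" by (simp_all add: algebra_simps)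
  then have "(of_int (p * (q + s)) :: rat) < of_int ((p + r) * q)"
    "(of_int ((p + r) * s) :: rat) < of_int (r * (q + s))" by (simp_all only: of_int_less_iff)
  then have "(of_int p :: rat) < of_int (p + r) * of_int q / of_int (q + s)"
    "of_int (p + r) * of_int s / of_int (q + s) < (of_int r :: rat)"
    using pos by (simp_all only: pos_less_divide_eq pos_divide_less_eq of_int_mult)
  moreover have "mid_rat w = of_int (p + r) / of_int (q + s)"
    by (simp add: mid_rat_def middle_interval[OF False I])
  ultimately show ?thesis by (simp add: between_def I)
qed (simp add: mid_rat_def middle_def between_def)

lemma between_children:
  "between (interval (False # w)) = {x \<in> between (interval w). x < mid_rat w}"
  "between (interval (True # w)) = {x \<in> between (interval w). mid_rat w < x}"
proof -
  obtain p q r s where I: "interval w = ((p, q), (r, s))" by (metis surj_pair)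
  have "between (interval (False # w)) = {x \<in> between (interval w). x < mid_rat w} \<and>
    between (interval (True # w)) = {x \<in> between (interval w). mid_rat w < x}"
  proof (cases "w = []")
    case False
    have pos: "(of_int (q + s) :: rat) > 0" using interval_denom_pos[OF False I] by linarith
    have lt: "x < mid_rat w \<longleftrightarrow> x * of_int q + x * of_int s < of_int p + of_int r"
      "mid_rat w < x \<longleftrightarrow> of_int p + of_int r < x * of_int q + x * of_int s" for x
      using pos by (simp_all add: mid_rat_def middle_interval[OF False I] pos_less_divide_eq
          pos_divide_less_eq distrib_left)
    \<comment> \<open>The inequality at the replaced endpoint follows by subtracting the one at the
      kept endpoint from the one at the mediant.\<close>
    show ?thesis
      by (auto simp: lt between_def middle_interval[OF False I] I[symmetric] distrib_left)
         (auto simp: I)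
  qed (auto simp: mid_rat_def middle_def between_def)
  then show "between (interval (False # w)) = {x \<in> between (interval w). x < mid_rat w}"
    "between (interval (True # w)) = {x \<in> between (interval w). mid_rat w < x}" by blast+
qed

lemma inj_mid_rat: "inj mid_rat"
proof (rule injI, rule ccontr)
  fix w w' assume eq: "mid_rat w = mid_rat w'" and "w \<noteq> w'"
  have "{mid_rat w} \<inter> {mid_rat w'} = {}"
  proof (rule tree_disjoint[where A = "\<lambda>w. between (interval w)" and M = "\<lambda>w. {mid_rat w}"])
    show "between (interval (b # w)) \<subseteq> between (interval w) - {mid_rat w}" for b w
      by (cases b) (auto simp: between_children simp del: interval.simps)
  qed (use \<open>w \<noteq> w'\<close> mid_rat_between in
        \<open>auto simp: between_children simp del: interval.simps\<close>)
  with eq show False by simp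
qed

section \<open>Every rational and every Farey edge occurs in the tree\<close>

lemma interval_right_infinity: "\<exists>w. interval w = ((int n, 1), (1, 0))"
proof (induction n)
  case 0
  show ?case by (intro exI[of _ "[True]"]) (simp add: middle_def)
next
  case (Suc n)
  then obtain w where "interval w = ((int n, 1), (1, 0))" by blast
  then show ?case by (intro exI[of _ "True # w"]) (simp add: middle_def)
qed

lemma interval_left_infinity: "\<exists>w. interval w = ((-1, 0), (- int n, 1))"
proof (induction n)
  case 0
  show ?case by (intro exI[of _ "[False]"]) (simp add: middle_def)
next
  case (Suc n)
  then obtain w where "interval w = ((-1, 0), (- int n, 1))" by blast
  then show ?case by (intro exI[of _ "False # w"]) (simp add: middle_def)
qed

lemma interval_unit: "\<exists>w. interval w = ((p, 1), (p + 1, 1))"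
proof (cases "p \<ge> 0")
  case True
  then obtain w where "interval w = ((p, 1), (1, 0))"
    using interval_right_infinity[of "nat p"] by auto
  then show ?thesis by (intro exI[of _ "False # w"]) (simp add: middle_def)
next
  case False
  then have "- int (nat (- (p + 1))) = p + 1" by simp
  then obtain w where "interval w = ((-1, 0), (p + 1, 1))"
    using interval_left_infinity[of "nat (- (p + 1))"] by metis
  then show ?thesis by (intro exI[of _ "True # w"]) (simp add: middle_def)
qed

text \<open>The endpoint of larger denominator is the mediant of the parent interval.\<close>

lemma interval_exists:
  assumes "q \<ge> 1" "s \<ge> 1" "q * r - p * s = 1"
  shows "\<exists>w. interval w = ((p, q), (r, s))"
  using assms
proof (induction "nat (q + s)" arbitrary: p q r s rule: less_induct)
  case less
  consider "q = s" | "q > s" | "s > q" by linarith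
  then show ?case
  proof cases
    case 1
    then have "q * (r - p) = 1" using less.prems by (simp add: algebra_simps)
    then have "q = 1" "r - p = 1" using less.prems by (auto simp: zmult_eq_1_iff)
    then show ?thesis using interval_unit[of p] 1 by (metis add.commute diff_eq_eq)
  next
    case 2
    have "(q - s) * r - (p - r) * s = 1" using less.prems by (simp add: algebra_simps)
    then obtain w where "interval w = ((p - r, q - s), (r, s))"
      using less.hyps[of "q - s" s r "p - r"] less.prems 2 by auto
    then show ?thesis using less.prems by (intro exI[of _ "True # w"]) (simp add: middle_def)
  next
    case 3
    have "q * (r - p) - p * (s - q) = 1" using less.prems by (simp add: algebra_simps)
    then obtain w where "interval w = ((p, q), (r - p, s - q))"
      using less.hyps[of q "s - q" "r - p" p] less.prems 3 by auto
    then show ?thesis using less.prems by (intro exI[of _ "False # w"]) (simp add: middle_def)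
  qed
qed

text \<open>The root's left endpoint has denominator \<open>0\<close>, so any other denominator
  shows that the endpoint was introduced as the mediant of an ancestor.\<close>

lemma fst_interval_middle:
  assumes "snd (fst (interval w)) \<noteq> 0"
  shows "\<exists>w'. middle (interval w') = fst (interval w)"
  using assms by (induction w) (auto split: if_splits)

lemma surj_mid_rat: "\<exists>w. mid_rat w = x"
proof -
  obtain p q where pq: "quotient_of x = (p, q)" by (metis surj_pair)
  have q: "q > 0" and cop: "coprime p q"
    using pq quotient_of_denom_pos quotient_of_coprime by metis+
  obtain a b where ab: "a * p + b * q = 1"
    using cop by (metis bezout_int coprime_iff_gcd_eq_1)
  define k where "k = \<bar>a\<bar> + 1"
  have "q * k \<ge> 1 * k" using q by (intro mult_right_mono) (auto simp: k_def)
  moreover have "k \<ge> a + 1" by (simp add: k_def)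
  ultimately have "q * k - a \<ge> 1" by linarith
  moreover have "q * (b + p * k) - p * (q * k - a) = 1" using ab by (simp add: algebra_simps)
  ultimately obtain w where "interval w = ((p, q), (b + p * k, q * k - a))"
    using interval_exists q by (metis int_one_le_iff_zero_less)
  then obtain w' where "middle (interval w') = (p, q)" using fst_interval_middle[of w] q by auto
  then have "mid_rat w' = x" using quotient_of_div[OF pq] by (simp add: mid_rat_def)
  then show ?thesis by blast
qed

lemma node_farey_frac: "node (farey_frac x) = x"
proof (cases x)
  case (Some y)
  obtain p q where pq: "quotient_of y = (p, q)" by (metis surj_pair)
  then show ?thesis using quotient_of_div[OF pq] quotient_of_denom_pos[OF pq] Some
    by (simp add: node_def farey_frac_def)
qed (simp add: node_def farey_frac_def)

lemma farey_frac_cases: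
  assumes "farey_frac x = (p, q)"
  obtains "p = 1" "q = 0" | "q \<ge> 1"
  using assms quotient_of_denom_pos by (cases x) (fastforce simp: farey_frac_def)+

text \<open>Only the unordered pair is claimed: next to a negative integer, infinity occurs as the
  left endpoint \<open>-1/0\<close>, although here it is the second vertex.\<close>

lemma farey_det_interval:
  assumes x: "farey_frac x = (a, b)" and y: "farey_frac y = (c, d)" and det: "b * c - a * d = 1"
  shows "\<exists>w. w \<noteq> [] \<and> {x, y} = {node (fst (interval w)), node (snd (interval w))}"
proof -
  have nx: "x = node (a, b)" and ny: "y = node (c, d)" using node_farey_frac x y by metis+
  consider "a = 1" "b = 0" | "c = 1" "d = 0" "b \<ge> 1" | "b \<ge> 1" "d \<ge> 1"
    using farey_frac_cases[OF x] farey_frac_cases[OF y] by metis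
  then show ?thesis
  proof cases
    case 1
    \<comment> \<open>This would force \<open>d = -1\<close>, but denominators are
      non-negative.\<close>
    then show ?thesis using det farey_frac_cases[OF y] by fastforce
  next
    case 2
    then have b: "b = 1" using det by simp
    show ?thesis
    proof (cases "a \<ge> 0")
      case True
      then obtain w where w: "interval w = ((a, 1), (1, 0))"
        using interval_right_infinity[of "nat a"] by auto
      then have "w \<noteq> []" by auto
      then show ?thesis using w 2 b nx ny by auto
    next
      case False
      then obtain w where w: "interval w = ((-1, 0), (a, 1))"
        using interval_left_infinity[of "nat (- a)"] by auto
      then have "w \<noteq> []" by auto
      then show ?thesis using w 2 b nx ny by (intro exI[of _ w]) (auto simp: node_def)
    qed
  next
    case 3
    then obtain w where w: "interval w = ((a, b), (c, d))" using interval_exists det by blast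
    then have "w \<noteq> []" using 3 by auto
    then show ?thesis using w nx ny by auto
  qed
qed

lemma Farey_E_interval:
  assumes "e \<in> Farey_E"
  shows "\<exists>w. w \<noteq> [] \<and> e = {node (fst (interval w)), node (snd (interval w))}"
proof -
  obtain x y where e: "e = {x, y}" "farey_adj x y" using assms by (auto simp: Farey_E_def)
  obtain a b where x: "farey_frac x = (a, b)" by (metis surj_pair)
  obtain c d where y: "farey_frac y = (c, d)" by (metis surj_pair)
  have "b * c - a * d = 1 \<or> d * a - c * b = 1"
    using e(2) x y by (auto simp: farey_adj_def algebra_simps)
  then show ?thesis
    using farey_det_interval[OF x y] farey_det_interval[OF y x] e(1) by (auto simp: insert_commute)
qed

section \<open>The tight minor\<close>

text \<open>Every Farey edge joins the endpoints of a non-root interval. One of them is the mediant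
  of the parent interval, and its branch set is adjacent to both ends of the parent's state.\<close>

lemma splits_tree_tight_minor:
  fixes V :: "'a set" and K Z :: "bool list \<Rightarrow> 'a set" and X Y :: "bool list \<Rightarrow> 'a"
  assumes tree: "\<And>w. splits V E (K w, X w, Y w) (Z w)
      (K (False # w), X (False # w), Y (False # w)) (K (True # w), X (True # w), Y (True # w))"
    and root: "{X [], Y []} \<in> E" "X [] \<in> V" "Y [] \<in> V" "X [] \<notin> K []" "Y [] \<notin> K []" "K [] \<subseteq> V"
  shows "tight_minor Farey_V Farey_E V E"
proof -
  note tree' = tree[unfolded splits_def prod.case]
  have KZ: "K (b # w) \<subseteq> K w - Z w" for b w using tree'[of w] by (cases b) auto
  have K0: "K w \<subseteq> K []" for w
    by (induction w) (use KZ in fastforce)+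
  have ZK: "Z w \<subseteq> K w" and Zfin: "finite (Z w)" and Zcon: "connected_set E (Z w)"
    and Zne: "Z w \<noteq> {}" for w using tree'[of w] by auto
  have Zdisj: "Z w \<inter> Z w' = {}" if "w \<noteq> w'" for w w'
    by (rule tree_disjoint[where A = K]) (use that KZ ZK tree' in blast)+
  \<comment> \<open>\<open>inv mid_rat\<close> recovers the position of a rational in the
    tree.\<close>
  define B where "B h = (case h of None \<Rightarrow> {X [], Y []} | Some x \<Rightarrow> Z (inv mid_rat x))" for h
  have Bmid: "B (node (middle (interval w))) = Z w" for w
    by (simp add: B_def node_middle inv_f_f[OF inj_mid_rat])
  \<comment> \<open>At a child, one end is inherited and the other lies in \<open>Z w\<close>, the
    branch set of the mediant.\<close>
  have ends: "X w \<in> B (node (fst (interval w))) \<and> Y w \<in> B (node (snd (interval w)))" for w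
  proof (induction w)
    case Nil
    then show ?case by (simp add: B_def node_def)
  next
    case (Cons b w)
    then show ?case using tree'[of w] by (cases b) (auto simp: Bmid)
  qed
  \<comment> \<open>At the root both endpoints are infinity, so no edge is asked for there.\<close>
  have adj: "\<exists>x\<in>B (node (fst (interval w))). \<exists>y\<in>B (node (snd (interval w))). {x, y} \<in> E"
    if "w \<noteq> []" for w
  proof -
    obtain b v where w: "w = b # v" using \<open>w \<noteq> []\<close> by (cases w) auto
    obtain z z' where z: "z \<in> Z v" "{X v, z} \<in> E" "z' \<in> Z v" "{z', Y v} \<in> E"
      using tree'[of v] by (auto simp: insert_commute)
    show ?thesis using ends[of v] z by (cases b) (auto simp: w Bmid)
  qed
  have "B h \<noteq> {} \<and> B h \<subseteq> V \<and> connected_set E (B h) \<and> finite (B h)" for h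
  proof (cases h)
    case None
    have "connected_set E {X [], Y []}"
      using connected_set_insert[of E "{X []}" "X []" "Y []"] root(1)
      by (simp add: connected_set_reach insert_commute)
    then show ?thesis using None root by (simp add: B_def)
  next
    case (Some x)
    then show ?thesis using Zne Zfin Zcon ZK K0 root(6) by (auto simp: B_def) blast
  qed
  moreover have "B h \<inter> B h' = {}" if "h \<noteq> h'" for h h'
  proof -
    have ninf: "{X [], Y []} \<inter> Z w = {}" for w using ZK[of w] K0[of w] root by blast
    have "inv mid_rat x \<noteq> inv mid_rat x'" if "x \<noteq> x'" for x x'
      using that surj_mid_rat by (metis f_inv_into_f rangeI)
    then show ?thesis using that ninf Zdisj
      by (cases h; cases h') (auto simp: B_def)
  qed
  moreover have "\<exists>x\<in>B h. \<exists>y\<in>B h'. {x, y} \<in> E" if hh: "{h, h'} \<in> Farey_E" for h h'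
  proof -
    obtain w where "w \<noteq> []" "{h, h'} = {node (fst (interval w)), node (snd (interval w))}"
      using Farey_E_interval[OF hh] by blast
    then show ?thesis using adj[of w] unfolding doubleton_eq_iff by (metis insert_commute)
  qed
  ultimately show ?thesis
    unfolding tight_minor_def minor_via_def by (intro exI[of _ B] conjI ballI allI impI) simp_all
qed

theorem theorem2:
  fixes V :: "'a set" and E :: "'a set set"
  assumes "Pi_graph V E"
  shows "tight_minor Farey_V Farey_E V E"
proof -
  have sg: "simple_graph V E" and ic: "inf_edge_connected V E"
    and noinf: "\<And>u v. u \<in> V \<Longrightarrow> v \<in> V \<Longrightarrow> \<not> inf_indep_paths V E u v"
    using assms unfolding Pi_graph_def by auto
  obtain x y where xy: "{x, y} \<in> E" "x \<in> V" "y \<in> V" "x \<noteq> y"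
  proof -
    obtain a b where ab: "a \<in> V" "b \<in> V" "a \<noteq> b" using ic unfolding inf_edge_connected_def by blast
    have "E \<noteq> {}"
    proof
      assume "E = {}"
      have "connected_set (E - {}) V" using ic unfolding inf_edge_connected_def by blast
      then have "reach E V a b" using ab by (simp add: connected_set_reach)
      then have "b = a" by (induction rule: reach_induct) (simp_all add: \<open>E = {}\<close>)
      with ab show False by simp
    qed
    then obtain e where "e \<in> E" by blast
    moreover from this obtain x y where "x \<noteq> y" "x \<in> V" "y \<in> V" "e = {x, y}"
      using sg unfolding simple_graph_def by metis
    ultimately show ?thesis using that by simp
  qed
  define good where "good s = (case s of (K, x, y) \<Rightarrow> inf_linked V E K x y)" for s :: "'a set \<times> 'a \<times> 'a"
  have "\<exists>t. splits V E s (fst t) (fst (snd t)) (snd (snd t))" if "good s" for s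
  proof -
    obtain K x y where s: "s = (K, x, y)" by (metis surj_pair)
    then have il: "inf_linked V E K x y" using \<open>good s\<close> by (simp add: good_def)
    then have "\<not> inf_indep_paths V E x y" using noinf by (simp add: inf_linked_def)
    then show ?thesis using inf_linked_splits[OF il] s by auto
  qed
  \<comment> \<open>\<open>f\<close> chooses a branch set and two child states for every good state;
    the children are good again, so the choice can be iterated.\<close>
  then obtain f where f: "\<And>s. good s \<Longrightarrow>
      splits V E s (fst (f s)) (fst (snd (f s))) (snd (snd (f s)))"
    by metis
  \<comment> \<open>\<open>foldr\<close> consumes a word from the right, as \<open>interval\<close>
    does, so states and intervals follow the same tree.\<close>
  define st where
    "st w = foldr (\<lambda>b s. if b then snd (snd (f s)) else fst (snd (f s))) w (V - {x, y}, x, y)" for w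
  have st: "st [] = (V - {x, y}, x, y)" "st (False # w) = fst (snd (f (st w)))"
    "st (True # w) = snd (snd (f (st w)))" for w
    by (simp_all add: st_def)
  have good_st: "good (st w)" for w
  proof (induction w)
    case Nil
    then show ?case using inf_linked_edge[OF ic] xy by (simp add: st good_def)
  next
    case (Cons b w)
    then show ?case using f[OF Cons]
      by (cases b) (auto simp: st splits_def good_def split: prod.splits)
  qed
  show ?thesis
    by (rule splits_tree_tight_minor[where K = "\<lambda>w. fst (st w)" and X = "\<lambda>w. fst (snd (st w))"
          and Y = "\<lambda>w. snd (snd (st w))" and Z = "\<lambda>w. fst (f (st w))"])
       (use f[OF good_st] xy in \<open>auto simp: st\<close>)
qed

end
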